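(* Let $G$ be a finite group, let $x\in \frac{\mathcal D^r(G)}{\mathrm{Aut}(G)\times \mathcal B_r}\times \frac{\mathcal D^s(G)}{\mathrm{Aut}(G)\times \mathcal B_s}$, and choose spherical systems of generators $V_1\in\mathcal D^r(G)$ and $V_2\in\mathcal D^s(G)$ such that $x=([V_1],[V_2])$. The following hold: (1) Given $\Phi\in \mathrm{Aut}(G)$, the class $[V_1,\Phi\cdot V_2]\in \frac{\mathcal D^r(G)\times \mathcal D^s(G)}{\mathrm{Aut}(G)\times \mathcal B_r\times \mathcal B_s}$ depends only on the class of $\Phi$ in $Q\mathrm{Aut}(G)_{V_1,V_2}$. (2) The map $$Q\mathrm{Aut}(G)_{V_1,V_2}\longrightarrow \pi^{-1}(x),\qquad [\Phi]\mapsto [V_1,\Phi\cdot V_2]$$ is bijective. In particular, $|\pi^{-1}(x)|=|Q\mathrm{Aut}(G)_{V_1,V_2}|$. (3) If $V_1$ is replaced by $V_1'=(\Psi_1,\sigma_1)\cdot V_1$ in the same $\mathrm{Aut}(G)\times \mathcal B_r$-orbit and $V_2$ by $V_2'=(\Psi_2,\sigma_2)\cdot V_2$ in the same $\mathrm{Aut}(G)\times\mathcal B_s$-orbit, then the bijection $Q\mathrm{Aut}(G)_{V_1,V_2}\to Q\mathrm{Aut}(G)_{V_1',V_2'}$, $[\Phi]\mapsto[\Psi_1\circ\Phi\circ\Psi_2^{-1}]$, together with the bijections of (2) for $(V_1,V_2)$ and for $(V_1',V_2')$ onto $\pi^{-1}(x)$, form a commutative triangle.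
   Context: A spherical system of generators of length $r$ of a finite group $G$ is a sequence $[g_1,\dots,g_r]\in G^r$ with $g_i\neq 1$ for all $i$, $G=\langle g_1,\dots,g_r\rangle$ and $g_1\cdots g_r=1$; $\mathcal D^r(G)$ is the set of all of them. The braid group $\mathcal B_r$ on $r$ strands, with standard generators $\sigma_1,\dots,\sigma_{r-1}$, acts on $\mathcal D^r(G)$ by $\sigma_i\cdot[g_1,\dots,g_r]=[g_1,\dots,g_{i-1},g_ig_{i+1}g_i^{-1},g_i,g_{i+2},\dots,g_r]$, and $\mathrm{Aut}(G)$ acts by $\Psi\cdot[g_1,\dots,g_r]=[\Psi(g_1),\dots,\Psi(g_r)]$; these actions commute. The group $\mathrm{Aut}(G)\times\mathcal B_r\times\mathcal B_s$ acts on $\mathcal D^r(G)\times\mathcal D^s(G)$, with $\mathrm{Aut}(G)$ acting simultaneously on both factors and $\mathcal B_r$, $\mathcal B_s$ acting on the first and second factor respectively. Square brackets $[V]$, $[V_1,V_2]$ denote orbits. The map $$\pi\colon \frac{\mathcal D^r(G)\times \mathcal D^s(G)}{\mathrm{Aut}(G)\times \mathcal B_r\times \mathcal B_s}\to \frac{\mathcal D^r(G)}{\mathrm{Aut}(G)\times \mathcal B_r}\times \frac{\mathcal D^s(G)}{\mathrm{Aut}(G)\times \mathcal B_s}$$ is the surjection $[V_1,V_2]\mapsto([V_1],[V_2])$. For $V\in\mathcal D^r(G)$, $\mathcal B\mathrm{Aut}(G,V):=\{\varphi\in\mathrm{Aut}(G): \exists\,\sigma\in\mathcal B_r \text{ with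 } \varphi\cdot V=\sigma\cdot V\}$, a subgroup of $\mathrm{Aut}(G)$. $Q\mathrm{Aut}(G)_{V_1,V_2}:=\mathcal B\mathrm{Aut}(G,V_1)\backslash\mathrm{Aut}(G)/\mathcal B\mathrm{Aut}(G,V_2)$ is the set of double cosets, i.e. the quotient of $\mathrm{Aut}(G)$ by the relation $\Phi\sim\Psi$ iff $\Psi=\varphi_1\circ\Phi\circ\varphi_2$ for some $\varphi_i\in\mathcal B\mathrm{Aut}(G,V_i)$. The map $[\Phi]\mapsto[\Psi_1\circ\Phi\circ\Psi_2^{-1}]$ in (3) is a well-defined bijection depending only on $V_1,V_2,V_1',V_2'$ and not on the choice of $\Psi_1,\Psi_2$. *)

theory Defs
  imports "HOL-Algebra.Group_Action" "HOL-Algebra.Generated_Groups"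
begin

section \<open>Braid groups by Artin's presentation\<close>

text \<open>
  Generators are numbered from \<open>0\<close>, in accordance with list positions: the letter \<open>(i, True)\<close> is
  the standard generator \<open>\<sigma>\<close> with index \<open>i + 1\<close>, and \<open>(i, False)\<close> is its inverse. On \<open>r\<close> strands
  the admissible indices are those with \<open>Suc i < r\<close>.
\<close>

type_synonym braid_word = "(nat \<times> bool) list"

definition braid_words :: "nat \<Rightarrow> braid_word set"
  where "braid_words r = {w. \<forall>(i, e) \<in> set w. Suc i < r}"

inductive braid_eq :: "nat \<Rightarrow> braid_word \<Rightarrow> braid_word \<Rightarrow> bool" for r :: nat where
  braid_eq_refl: "w \<in> braid_words r \<Longrightarrow> braid_eq r w w"
| braid_eq_sym: "braid_eq r u v \<Longrightarrow> braid_eq r v u"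
| braid_eq_trans: "braid_eq r u v \<Longrightarrow> braid_eq r v w \<Longrightarrow> braid_eq r u w"
| braid_eq_cong: "braid_eq r u u' \<Longrightarrow> braid_eq r v v' \<Longrightarrow> braid_eq r (u @ v) (u' @ v')"
| braid_eq_cancel: "Suc i < r \<Longrightarrow> braid_eq r [(i, e), (i, \<not> e)] []"
| braid_eq_braid: "Suc (Suc i) < r \<Longrightarrow>
    braid_eq r [(i, True), (Suc i, True), (i, True)] [(Suc i, True), (i, True), (Suc i, True)]"
| braid_eq_far: "Suc i < j \<Longrightarrow> Suc j < r \<Longrightarrow> braid_eq r [(i, True), (j, True)] [(j, True), (i, True)]"

definition braid_rel :: "nat \<Rightarrow> (braid_word \<times> braid_word) set"
  where "braid_rel r = {(u, v). braid_eq r u v}"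

definition braid_group :: "nat \<Rightarrow> braid_word set monoid"
  where "braid_group r =
    \<lparr>carrier = braid_words r // braid_rel r,
     mult = (\<lambda>A B. \<Union>u\<in>A. \<Union>v\<in>B. braid_rel r `` {u @ v}),
     one = braid_rel r `` {[]}\<rparr>"


section \<open>Spherical systems of generators and the actions on them\<close>

definition spherical :: "('a, 'b) monoid_scheme \<Rightarrow> nat \<Rightarrow> 'a list set"
  where "spherical G r = {V. length V = r \<and> set V \<subseteq> carrier G \<and> \<one>\<^bsub>G\<^esub> \<notin> set V \<and>
    generate G (set V) = carrier G \<and> foldr (\<otimes>\<^bsub>G\<^esub>) V \<one>\<^bsub>G\<^esub> = \<one>\<^bsub>G\<^esub>}"

fun hurwitz_letter :: "('a, 'b) monoid_scheme \<Rightarrow> nat \<times> bool \<Rightarrow> 'a list \<Rightarrow> 'a list" where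
  "hurwitz_letter G (i, True) V =
     V[i := V ! i \<otimes>\<^bsub>G\<^esub> V ! Suc i \<otimes>\<^bsub>G\<^esub> inv\<^bsub>G\<^esub> (V ! i), Suc i := V ! i]"
| "hurwitz_letter G (i, False) V =
     V[i := V ! Suc i, Suc i := inv\<^bsub>G\<^esub> (V ! Suc i) \<otimes>\<^bsub>G\<^esub> V ! i \<otimes>\<^bsub>G\<^esub> V ! Suc i]"

text \<open>For a left action the last letter of a word acts first, hence \<open>foldr\<close>.\<close>

definition hurwitz_word :: "('a, 'b) monoid_scheme \<Rightarrow> braid_word \<Rightarrow> 'a list \<Rightarrow> 'a list"
  where "hurwitz_word G w V = foldr (hurwitz_letter G) w V"

text \<open>
  On \<open>spherical G r\<close> all words in a class act in the same way (see \<open>braid_act_class\<close> below), so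
  that the image of the class is a singleton.
\<close>

definition braid_act :: "('a, 'b) monoid_scheme \<Rightarrow> braid_word set \<Rightarrow> 'a list \<Rightarrow> 'a list"
  where "braid_act G \<sigma> V = the_elem ((\<lambda>w. hurwitz_word G w V) ` \<sigma>)"

definition aut_act :: "('a \<Rightarrow> 'a) \<Rightarrow> 'a list \<Rightarrow> 'a list"
  where "aut_act \<Psi> V = map \<Psi> V"

text \<open>The actions are restricted to their domain, as \<^locale>\<open>group_action\<close> requires.\<close>

definition sph_act ::
    "('a, 'b) monoid_scheme \<Rightarrow> nat \<Rightarrow> ('a \<Rightarrow> 'a) \<times> braid_word set \<Rightarrow> 'a list \<Rightarrow> 'a list"
  where "sph_act G r = (\<lambda>(\<Psi>, \<sigma>). \<lambda>V\<in>spherical G r. aut_act \<Psi> (braid_act G \<sigma> V))"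

definition sph_act2 ::
    "('a, 'b) monoid_scheme \<Rightarrow> nat \<Rightarrow> nat \<Rightarrow> ('a \<Rightarrow> 'a) \<times> braid_word set \<times> braid_word set \<Rightarrow>
     'a list \<times> 'a list \<Rightarrow> 'a list \<times> 'a list"
  where "sph_act2 G r s = (\<lambda>(\<Psi>, \<sigma>, \<tau>). \<lambda>p\<in>spherical G r \<times> spherical G s.
    (sph_act G r (\<Psi>, \<sigma>) (fst p), sph_act G s (\<Psi>, \<tau>) (snd p)))"

definition sph_class :: "('a, 'b) monoid_scheme \<Rightarrow> nat \<Rightarrow> 'a list \<Rightarrow> 'a list set"
  where "sph_class G r V = orbit (AutoGroup G \<times>\<times> braid_group r) (sph_act G r) V"

definition sph_quot :: "('a, 'b) monoid_scheme \<Rightarrow> nat \<Rightarrow> 'a list set set"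
  where "sph_quot G r = orbits (AutoGroup G \<times>\<times> braid_group r) (spherical G r) (sph_act G r)"

definition sph_class2 ::
    "('a, 'b) monoid_scheme \<Rightarrow> nat \<Rightarrow> nat \<Rightarrow> 'a list \<times> 'a list \<Rightarrow> ('a list \<times> 'a list) set"
  where "sph_class2 G r s p =
    orbit (AutoGroup G \<times>\<times> braid_group r \<times>\<times> braid_group s) (sph_act2 G r s) p"

definition sph_quot2 ::
    "('a, 'b) monoid_scheme \<Rightarrow> nat \<Rightarrow> nat \<Rightarrow> ('a list \<times> 'a list) set set"
  where "sph_quot2 G r s = orbits (AutoGroup G \<times>\<times> braid_group r \<times>\<times> braid_group s)
    (spherical G r \<times> spherical G s) (sph_act2 G r s)"

text \<open>Well-definedness of the next map is \<open>sph_proj_class\<close> below.\<close>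

definition sph_proj ::
    "('a, 'b) monoid_scheme \<Rightarrow> nat \<Rightarrow> nat \<Rightarrow> ('a list \<times> 'a list) set \<Rightarrow> 'a list set \<times> 'a list set"
  where "sph_proj G r s c = the_elem ((\<lambda>(V, W). (sph_class G r V, sph_class G s W)) ` c)"

definition sph_fibre ::
    "('a, 'b) monoid_scheme \<Rightarrow> nat \<Rightarrow> nat \<Rightarrow> 'a list set \<times> 'a list set \<Rightarrow>
     ('a list \<times> 'a list) set set"
  where "sph_fibre G r s x = {c \<in> sph_quot2 G r s. sph_proj G r s c = x}"


section \<open>The double coset space and the maps from it\<close>

definition BAut :: "('a, 'b) monoid_scheme \<Rightarrow> nat \<Rightarrow> 'a list \<Rightarrow> ('a \<Rightarrow> 'a) set"
  where "BAut G r V =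
    {\<phi> \<in> carrier (AutoGroup G). \<exists>\<sigma> \<in> carrier (braid_group r). aut_act \<phi> V = braid_act G \<sigma> V}"

definition qaut_rel ::
    "('a, 'b) monoid_scheme \<Rightarrow> nat \<Rightarrow> nat \<Rightarrow> 'a list \<Rightarrow> 'a list \<Rightarrow> (('a \<Rightarrow> 'a) \<times> ('a \<Rightarrow> 'a)) set"
  where "qaut_rel G r s V1 V2 =
    {(\<Phi>, \<Psi>). \<Phi> \<in> carrier (AutoGroup G) \<and> \<Psi> \<in> carrier (AutoGroup G) \<and>
      (\<exists>\<phi>1 \<in> BAut G r V1. \<exists>\<phi>2 \<in> BAut G s V2.
        \<Psi> = \<phi>1 \<otimes>\<^bsub>AutoGroup G\<^esub> \<Phi> \<otimes>\<^bsub>AutoGroup G\<^esub> \<phi>2)}"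

definition QAut ::
    "('a, 'b) monoid_scheme \<Rightarrow> nat \<Rightarrow> nat \<Rightarrow> 'a list \<Rightarrow> 'a list \<Rightarrow> ('a \<Rightarrow> 'a) set set"
  where "QAut G r s V1 V2 = carrier (AutoGroup G) // qaut_rel G r s V1 V2"

definition qaut_class ::
    "('a, 'b) monoid_scheme \<Rightarrow> nat \<Rightarrow> nat \<Rightarrow> 'a list \<Rightarrow> 'a list \<Rightarrow> ('a \<Rightarrow> 'a) \<Rightarrow> ('a \<Rightarrow> 'a) set"
  where "qaut_class G r s V1 V2 \<Phi> = qaut_rel G r s V1 V2 `` {\<Phi>}"

text \<open>
  The maps \<open>[\<Phi>] \<mapsto> [V1, \<Phi> \<cdot> V2]\<close> and \<open>[\<Phi>] \<mapsto> [\<Psi>1 \<circ> \<Phi> \<circ> \<Psi>2\<^sup>-\<^sup>1]\<close>. The value is the common value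
  on all representatives of the class, and is meaningful only where the formula is independent of
  the representative.
\<close>

definition qaut_map ::
    "('a, 'b) monoid_scheme \<Rightarrow> nat \<Rightarrow> nat \<Rightarrow> 'a list \<Rightarrow> 'a list \<Rightarrow> ('a \<Rightarrow> 'a) set \<Rightarrow>
     ('a list \<times> 'a list) set"
  where "qaut_map G r s V1 V2 q = the_elem ((\<lambda>\<Phi>. sph_class2 G r s (V1, aut_act \<Phi> V2)) ` q)"

definition qaut_transfer ::
    "('a, 'b) monoid_scheme \<Rightarrow> nat \<Rightarrow> nat \<Rightarrow> 'a list \<Rightarrow> 'a list \<Rightarrow> ('a \<Rightarrow> 'a) \<Rightarrow> ('a \<Rightarrow> 'a) \<Rightarrow>
     ('a \<Rightarrow> 'a) set \<Rightarrow> ('a \<Rightarrow> 'a) set"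
  where "qaut_transfer G r s V1' V2' \<Psi>1 \<Psi>2 q =
    the_elem ((\<lambda>\<Phi>. qaut_class G r s V1' V2'
      (\<Psi>1 \<otimes>\<^bsub>AutoGroup G\<^esub> \<Phi> \<otimes>\<^bsub>AutoGroup G\<^esub> inv\<^bsub>AutoGroup G\<^esub> \<Psi>2)) ` q)"


section \<open>The groups and actions are as expected\<close>

lemma braid_eq_words: "braid_eq r u v \<Longrightarrow> u \<in> braid_words r \<and> v \<in> braid_words r"
  by (induction rule: braid_eq.induct) (auto simp: braid_words_def)

lemma equiv_braid_rel: "equiv (braid_words r) (braid_rel r)"
proof (rule equivI)
  show "braid_rel r \<subseteq> braid_words r \<times> braid_words r"
    using braid_eq_words by (auto simp: braid_rel_def)
  show "refl_on (braid_words r) (braid_rel r)"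
    by (auto simp: refl_on_def braid_rel_def intro: braid_eq_refl)
  show "Relation.sym (braid_rel r)"
    by (auto simp: sym_def braid_rel_def intro: braid_eq_sym)
  show "Relation.trans (braid_rel r)"
    unfolding Relation.trans_def braid_rel_def by (auto intro: braid_eq_trans)
qed

lemma append_words: "u \<in> braid_words r \<Longrightarrow> v \<in> braid_words r \<Longrightarrow> u @ v \<in> braid_words r"
  by (auto simp: braid_words_def)

lemma braid_carrierE:
  assumes "A \<in> carrier (braid_group r)"
  obtains u where "u \<in> braid_words r" "A = braid_rel r `` {u}"
  using assms by (auto simp: braid_group_def elim: quotientE)

lemma braid_carrierI: "u \<in> braid_words r \<Longrightarrow> braid_rel r `` {u} \<in> carrier (braid_group r)"
  by (simp add: braid_group_def quotientI)

lemma braid_one: "\<one>\<^bsub>braid_group r\<^esub> = braid_rel r `` {[]}"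
  by (simp add: braid_group_def)

lemma braid_class_eq: "braid_eq r u v \<Longrightarrow> braid_rel r `` {u} = braid_rel r `` {v}"
  by (rule equiv_class_eq[OF equiv_braid_rel]) (simp add: braid_rel_def)

lemma braid_mult:
  assumes "u \<in> braid_words r" "v \<in> braid_words r"
  shows "(braid_rel r `` {u}) \<otimes>\<^bsub>braid_group r\<^esub> (braid_rel r `` {v}) = braid_rel r `` {u @ v}"
proof -
  have "braid_rel r `` {u' @ v'} = braid_rel r `` {u @ v}"
    if "braid_eq r u u'" "braid_eq r v v'" for u' v'
    using that by (intro braid_class_eq) (blast intro: braid_eq_sym braid_eq_cong)
  then have "(\<Union>u'\<in>braid_rel r `` {u}. \<Union>v'\<in>braid_rel r `` {v}. braid_rel r `` {u' @ v'}) =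
      (\<Union>u'\<in>braid_rel r `` {u}. \<Union>v'\<in>braid_rel r `` {v}. braid_rel r `` {u @ v})"
    by (intro SUP_cong) (auto simp: braid_rel_def)
  moreover have "braid_rel r `` {u} \<noteq> {}" "braid_rel r `` {v} \<noteq> {}"
    using assms braid_eq_refl by (force simp: braid_rel_def)+
  ultimately show ?thesis unfolding braid_group_def by simp
qed

lemma braid_inverse:
  "w \<in> braid_words r \<Longrightarrow> braid_eq r (rev (map (\<lambda>(i, e). (i, \<not> e)) w) @ w) []"
proof (induction w)
  case Nil
  then show ?case by (auto intro: braid_eq_refl)
next
  case (Cons a w)
  obtain i e where a: "a = (i, e)" by force
  have w: "w \<in> braid_words r" and i: "Suc i < r" using Cons.prems by (auto simp: braid_words_def a)
  let ?W = "rev (map (\<lambda>(i, e). (i, \<not> e)) w)"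
  have W: "?W \<in> braid_words r" using w by (auto simp: braid_words_def)
  have c: "braid_eq r [(i, \<not> e), (i, e)] []" using braid_eq_cancel[OF i, of "\<not> e"] by simp
  have "braid_eq r (?W @ [(i, \<not> e), (i, e)]) (?W @ [])"
    by (rule braid_eq_cong[OF braid_eq_refl[OF W] c])
  then have "braid_eq r ((?W @ [(i, \<not> e), (i, e)]) @ w) ((?W @ []) @ w)"
    by (rule braid_eq_cong[OF _ braid_eq_refl[OF w]])
  then show ?case using Cons.IH[OF w] i a by (auto intro: braid_eq_trans)
qed

lemma group_braid_group: "group (braid_group r)"
proof (rule groupI)
  fix x y assume "x \<in> carrier (braid_group r)" "y \<in> carrier (braid_group r)"
  then show "x \<otimes>\<^bsub>braid_group r\<^esub> y \<in> carrier (braid_group r)"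
    by (elim braid_carrierE) (simp add: braid_mult braid_carrierI append_words)
next
  show "\<one>\<^bsub>braid_group r\<^esub> \<in> carrier (braid_group r)"
    unfolding braid_one by (rule braid_carrierI) (simp add: braid_words_def)
next
  fix x y z
  assume "x \<in> carrier (braid_group r)" "y \<in> carrier (braid_group r)" "z \<in> carrier (braid_group r)"
  then show "x \<otimes>\<^bsub>braid_group r\<^esub> y \<otimes>\<^bsub>braid_group r\<^esub> z =
      x \<otimes>\<^bsub>braid_group r\<^esub> (y \<otimes>\<^bsub>braid_group r\<^esub> z)"
    by (elim braid_carrierE) (simp add: braid_mult append_words)
next
  fix x assume "x \<in> carrier (braid_group r)"
  then show "\<one>\<^bsub>braid_group r\<^esub> \<otimes>\<^bsub>braid_group r\<^esub> x = x"
    by (elim braid_carrierE) (simp add: braid_one braid_mult braid_words_def)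
next
  fix x assume "x \<in> carrier (braid_group r)"
  then obtain w where w: "w \<in> braid_words r" "x = braid_rel r `` {w}" by (rule braid_carrierE)
  let ?W = "rev (map (\<lambda>(i, e). (i, \<not> e)) w)"
  have W: "?W \<in> braid_words r" using w by (auto simp: braid_words_def)
  have "(braid_rel r `` {?W}) \<otimes>\<^bsub>braid_group r\<^esub> x = \<one>\<^bsub>braid_group r\<^esub>"
    unfolding w(2) braid_mult[OF W w(1)] braid_one
    by (rule braid_class_eq[OF braid_inverse[OF w(1)]])
  then show "\<exists>y \<in> carrier (braid_group r). y \<otimes>\<^bsub>braid_group r\<^esub> x = \<one>\<^bsub>braid_group r\<^esub>"
    using braid_carrierI[OF W] by blast
qed

lemma hurwitz_letter_append:
  assumes "i = length xs"
  shows "hurwitz_letter G (i, True) (xs @ a # b # ys) =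
      xs @ (a \<otimes>\<^bsub>G\<^esub> b \<otimes>\<^bsub>G\<^esub> inv\<^bsub>G\<^esub> a) # a # ys"
    and "hurwitz_letter G (i, False) (xs @ a # b # ys) =
      xs @ b # (inv\<^bsub>G\<^esub> b \<otimes>\<^bsub>G\<^esub> a \<otimes>\<^bsub>G\<^esub> b) # ys"
  by (simp_all add: assms nth_append list_update_append)

declare hurwitz_letter.simps [simp del]

lemma list_split2:
  assumes "Suc i < length V"
  obtains xs a b ys where "V = xs @ a # b # ys" "i = length xs"
proof
  show "V = take i V @ V ! i # V ! Suc i # drop (Suc (Suc i)) V"
    using assms by (metis Cons_nth_drop_Suc Suc_lessD append_take_drop_id)
qed (use assms in simp)

lemma list_split3:
  assumes "Suc (Suc i) < length V"
  obtains xs a b c ys where "V = xs @ a # b # c # ys" "i = length xs"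
proof -
  obtain xs a b ys where 1: "V = xs @ a # b # ys" "i = length xs"
    using assms by (meson Suc_lessD list_split2)
  then obtain c zs where "ys = c # zs" using assms by (cases ys) auto
  then show thesis using 1 that by blast
qed

lemma (in group_action) orbit_act_eq:
  assumes g: "g \<in> carrier G" and x: "x \<in> E"
  shows "orbit G \<phi> (\<phi> g x) = orbit G \<phi> x"
proof -
  interpret group G using group_hom group_hom.axioms(1) by auto
  have 1: "\<phi> h (\<phi> g x) = \<phi> (h \<otimes> g) x" if "h \<in> carrier G" for h
    using composition_rule[OF x that g] by simp
  have 2: "\<phi> h x = \<phi> (h \<otimes> inv g) (\<phi> g x)" if "h \<in> carrier G" for h
    using composition_rule[OF x, of "h \<otimes> inv g" g] that g by (simp add: m_assoc)
  show ?thesis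
  proof (intro subset_antisym subsetI)
    fix y assume "y \<in> orbit G \<phi> (\<phi> g x)"
    then obtain h where "h \<in> carrier G" "y = \<phi> h (\<phi> g x)" by (auto simp: orbit_def)
    then show "y \<in> orbit G \<phi> x"
      using 1[of h] g unfolding orbit_def by (intro CollectI exI[of _ "h \<otimes> g"]) simp
  next
    fix y assume "y \<in> orbit G \<phi> x"
    then obtain h where "h \<in> carrier G" "y = \<phi> h x" by (auto simp: orbit_def)
    then show "y \<in> orbit G \<phi> (\<phi> g x)"
      using 2[of h] g unfolding orbit_def by (intro CollectI exI[of _ "h \<otimes> inv g"]) simp
  qed
qed

context group begin

lemma foldr_mult_append:
  "set xs \<subseteq> carrier G \<Longrightarrow> set ys \<subseteq> carrier G \<Longrightarrow>
    foldr (\<otimes>) (xs @ ys) \<one> = foldr (\<otimes>) xs \<one> \<otimes> foldr (\<otimes>) ys \<one> \<and>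
    foldr (\<otimes>) xs \<one> \<in> carrier G"
proof (induction xs)
  case Nil
  have "foldr (\<otimes>) ys \<one> \<in> carrier G" using Nil(2) by (induction ys) auto
  then show ?case by simp
next
  case (Cons a xs)
  have "foldr (\<otimes>) ys \<one> \<in> carrier G" using Cons(3) by (induction ys) auto
  then show ?case using Cons by (auto simp: m_assoc)
qed

lemma mul_inv_cancel: "a \<in> carrier G \<Longrightarrow> b \<in> carrier G \<Longrightarrow> a \<otimes> (inv a \<otimes> b) = b"
  "a \<in> carrier G \<Longrightarrow> b \<in> carrier G \<Longrightarrow> inv a \<otimes> (a \<otimes> b) = b"
  by (simp_all add: m_assoc[symmetric])

lemma hurwitz_cancel:
  assumes "set V \<subseteq> carrier G" "Suc i < length V"
  shows "hurwitz_letter G (i, e) (hurwitz_letter G (i, \<not> e) V) = V"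
proof -
  obtain xs a b ys where V: "V = xs @ a # b # ys" and i: "i = length xs" using assms list_split2 by metis
  have "a \<in> carrier G" "b \<in> carrier G" using assms V by auto
  then show ?thesis
    by (cases e) (simp_all add: V hurwitz_letter_append[OF i] m_assoc mul_inv_cancel inv_mult_group)
qed

lemma hurwitz_subset:
  assumes V: "set V \<subseteq> carrier G" and i: "Suc i < length V"
  shows "set (hurwitz_letter G (i, e) V) \<subseteq> generate G (set V)"
proof -
  obtain xs a b ys where V: "V = xs @ a # b # ys" and i: "i = length xs" using assms list_split2 by metis
  have g: "c \<in> generate G (set V)" if "c \<in> set V" for c using that by (rule generate.incl)
  have h: "inv c \<in> generate G (set V)" if "c \<in> set V" for c using that by (rule generate.inv)
  have ab: "a \<in> set V" "b \<in> set V" using V by auto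
  show ?thesis
  proof (cases e)
    case True
    have "a \<otimes> b \<otimes> inv a \<in> generate G (set V)" using g h ab by (intro generate.eng) auto
    moreover have "set (hurwitz_letter G (i, e) V) \<subseteq> insert (a \<otimes> b \<otimes> inv a) (set V)"
      using True by (auto simp: V hurwitz_letter_append[OF i])
    ultimately show ?thesis using g by blast
  next
    case False
    have "inv b \<otimes> a \<otimes> b \<in> generate G (set V)" using g h ab by (intro generate.eng) auto
    moreover have "set (hurwitz_letter G (i, e) V) \<subseteq> insert (inv b \<otimes> a \<otimes> b) (set V)"
      using False by (auto simp: V hurwitz_letter_append[OF i])
    ultimately show ?thesis using g by blast
  qed
qed

lemma hurwitz_length: "length (hurwitz_letter G (i, e) V) = length V"
  by (cases e) (auto simp: hurwitz_letter.simps)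

lemma hurwitz_closed:
  assumes "V \<in> spherical G r" and "Suc i < r"
  shows "hurwitz_letter G (i, e) V \<in> spherical G r"
proof -
  have sV: "set V \<subseteq> carrier G" "Suc i < length V" "length V = r" using assms by (auto simp: spherical_def)
  let ?W = "hurwitz_letter G (i, e) V"
  obtain xs a b ys where V: "V = xs @ a # b # ys" and i: "i = length xs"
    using sV list_split2 by metis
  have c: "a \<in> carrier G" "b \<in> carrier G" "set xs \<subseteq> carrier G" "set ys \<subseteq> carrier G"
    using sV V by auto
  have sW: "set ?W \<subseteq> carrier G"
    using hurwitz_subset[OF sV(1,2)] generate_incl[OF sV(1)] by blast
  have "set ?W \<subseteq> generate G (set V)" using hurwitz_subset[OF sV(1,2)] .
  moreover have "set V \<subseteq> generate G (set ?W)"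
    using hurwitz_subset[of ?W i "\<not> e"] hurwitz_cancel[OF sV(1,2), of "\<not> e"] sW sV
    by (simp add: hurwitz_length)
  ultimately have gen: "generate G (set ?W) = generate G (set V)"
    by (meson generate_is_subgroup generate_subgroup_incl sV(1) sW subset_antisym)
  have n: "a \<noteq> \<one>" "b \<noteq> \<one>" "\<one> \<notin> set xs" "\<one> \<notin> set ys" using assms V by (auto simp: spherical_def)
  have n1: "a \<otimes> b \<otimes> inv a \<noteq> \<one>"
  proof
    assume "a \<otimes> b \<otimes> inv a = \<one>"
    then have "a \<otimes> b = a" using c by (metis inv_equality inv_inv m_closed inv_closed)
    then show False using c n by simp
  qed
  have n2: "inv b \<otimes> a \<otimes> b \<noteq> \<one>"
  proof
    assume "inv b \<otimes> a \<otimes> b = \<one>"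
    then have "inv b \<otimes> a = inv b" using c by (metis inv_equality inv_closed m_closed)
    then show False using c n by simp
  qed
  have "\<one> \<notin> set ?W"
    using n n1 n2 by (cases e) (auto simp: V hurwitz_letter_append[OF i])
  moreover have "foldr (\<otimes>) ?W \<one> = foldr (\<otimes>) V \<one>"
  proof -
    have y: "foldr (\<otimes>) ys \<one> \<in> carrier G" using foldr_mult_append[OF c(4), of "[]"] by simp
    show ?thesis
      using c y by (cases e) (simp_all add: V hurwitz_letter_append[OF i] foldr_mult_append m_assoc mul_inv_cancel)
  qed
  ultimately show ?thesis using assms gen sW by (simp add: spherical_def hurwitz_length)
qed

lemma hurwitz_word_closed:
  "w \<in> braid_words r \<Longrightarrow> V \<in> spherical G r \<Longrightarrow> hurwitz_word G w V \<in> spherical G r"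
  by (induction w) (auto simp: hurwitz_word_def braid_words_def hurwitz_closed)

lemma hurwitz_word_append: "hurwitz_word G (u @ v) V = hurwitz_word G u (hurwitz_word G v V)"
  by (simp add: hurwitz_word_def)

lemma hurwitz_far:
  assumes "V \<in> spherical G r" "Suc i < j" "Suc j < r"
  shows "hurwitz_letter G (i, True) (hurwitz_letter G (j, True) V) =
         hurwitz_letter G (j, True) (hurwitz_letter G (i, True) V)"
  using assms by (auto simp: hurwitz_letter.simps spherical_def nth_list_update list_update_swap intro!: nth_equalityI)

lemma hurwitz_braid:
  assumes "V \<in> spherical G r" "Suc (Suc i) < r"
  shows "hurwitz_letter G (i, True) (hurwitz_letter G (Suc i, True) (hurwitz_letter G (i, True) V)) =
         hurwitz_letter G (Suc i, True) (hurwitz_letter G (i, True) (hurwitz_letter G (Suc i, True) V))"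
proof -
  have V: "set V \<subseteq> carrier G" "Suc (Suc i) < length V" using assms by (auto simp: spherical_def)
  then obtain xs a b c ys where W: "V = xs @ a # b # c # ys" and i: "i = length xs"
    using list_split3 by metis
  have abc: "a \<in> carrier G" "b \<in> carrier G" "c \<in> carrier G" using V W by auto
  have s: "hurwitz_letter G (Suc i, True) (xs @ p # q # t # ys) =
      xs @ p # (q \<otimes> t \<otimes> inv q) # q # ys" for p q t
    using hurwitz_letter_append(1)[of "Suc i" "xs @ [p]" G q t ys] i by simp
  show ?thesis
    using abc unfolding W
    by (simp only: s hurwitz_letter_append(1)[OF i]) (simp add: m_assoc mul_inv_cancel inv_mult_group)
qed

lemma hurwitz_word_eq:
  "braid_eq r u v \<Longrightarrow> V \<in> spherical G r \<Longrightarrow> hurwitz_word G u V = hurwitz_word G v V"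
proof (induction arbitrary: V rule: braid_eq.induct)
  case (braid_eq_cong u u' v v')
  then show ?case using braid_eq_words hurwitz_word_closed by (metis hurwitz_word_append)
next
  case (braid_eq_cancel i e)
  then show ?case using hurwitz_cancel[of V i e] by (simp add: hurwitz_word_def spherical_def)
next
  case (braid_eq_braid i)
  then show ?case using hurwitz_braid[of V r i] by (simp add: hurwitz_word_def)
next
  case (braid_eq_far i j)
  then show ?case using hurwitz_far[of V r i j] by (simp add: hurwitz_word_def)
next
  case (braid_eq_sym u v)
  then show ?case by metis
next
  case (braid_eq_trans u v w)
  then show ?case by metis
qed simp

lemma braid_act_class:
  assumes "w \<in> braid_words r" "V \<in> spherical G r"
  shows "braid_act G (braid_rel r `` {w}) V = hurwitz_word G w V"
proof -
  have "hurwitz_word G u V = hurwitz_word G w V" if "u \<in> braid_rel r `` {w}" for u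
    using hurwitz_word_eq[of r w u V] that assms(2) by (simp add: braid_rel_def)
  moreover have "w \<in> braid_rel r `` {w}"
    using braid_eq_refl[OF assms(1)] by (simp add: braid_rel_def)
  ultimately have "(\<lambda>u. hurwitz_word G u V) ` (braid_rel r `` {w}) = {hurwitz_word G w V}"
    by blast
  then show ?thesis by (simp add: braid_act_def)
qed

lemma braid_act_closed:
  "\<sigma> \<in> carrier (braid_group r) \<Longrightarrow> V \<in> spherical G r \<Longrightarrow> braid_act G \<sigma> V \<in> spherical G r"
  by (elim braid_carrierE) (simp add: braid_act_class hurwitz_word_closed)

lemma braid_act_mult:
  assumes "\<sigma> \<in> carrier (braid_group r)" "\<tau> \<in> carrier (braid_group r)" "V \<in> spherical G r"
  shows "braid_act G (\<sigma> \<otimes>\<^bsub>braid_group r\<^esub> \<tau>) V = braid_act G \<sigma> (braid_act G \<tau> V)"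
  using assms by (elim braid_carrierE)
    (simp add: braid_mult braid_act_class append_words hurwitz_word_append hurwitz_word_closed)

lemma braid_act_one: "V \<in> spherical G r \<Longrightarrow> braid_act G \<one>\<^bsub>braid_group r\<^esub> V = V"
  by (simp add: braid_one braid_act_class[of "[]" r] braid_words_def hurwitz_word_def)

lemma autoD:
  assumes "\<Psi> \<in> carrier (AutoGroup G)"
  shows "\<Psi> \<in> hom G G" "bij_betw \<Psi> (carrier G) (carrier G)" "group_hom G G \<Psi>"
  using assms by (auto simp: AutoGroup_def auto_def Bij_def group_hom_def group_hom_axioms_def is_group)

lemma aut_act_closed:
  assumes P: "\<Psi> \<in> carrier (AutoGroup G)" and V: "V \<in> spherical G r"
  shows "aut_act \<Psi> V \<in> spherical G r"
proof -
  interpret group_hom G G \<Psi> by (rule autoD(3)[OF P])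
  have S: "set V \<subseteq> carrier G" "\<one> \<notin> set V" "generate G (set V) = carrier G"
    using V by (auto simp: spherical_def)
  have im: "\<Psi> ` carrier G = carrier G" and inj: "inj_on \<Psi> (carrier G)"
    using autoD(2)[OF P] by (auto simp: bij_betw_def)
  have "generate G (\<Psi> ` set V) = carrier G"
    using generate_img[OF S(1)] S im by simp
  moreover have "\<one> \<notin> \<Psi> ` set V"
  proof
    assume "\<one> \<in> \<Psi> ` set V"
    then obtain v where v: "v \<in> set V" "\<Psi> v = \<Psi> \<one>" using hom_one by auto
    then have "v = \<one>" using inj_onD[OF inj v(2)] S(1) by blast
    then show False using v S(2) by simp
  qed
  moreover have "foldr (\<otimes>) (map \<Psi> W) \<one> = \<Psi> (foldr (\<otimes>) W \<one>) \<and> foldr (\<otimes>) W \<one> \<in> carrier G"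
    if "set W \<subseteq> carrier G" for W
    using that by (induction W) auto
  ultimately show ?thesis using V S im by (auto simp: spherical_def aut_act_def)
qed

lemma aut_act_hurwitz:
  assumes P: "\<Psi> \<in> carrier (AutoGroup G)" and V: "V \<in> spherical G r" and i: "Suc i < r"
  shows "aut_act \<Psi> (hurwitz_letter G (i, e) V) = hurwitz_letter G (i, e) (aut_act \<Psi> V)"
proof -
  interpret group_hom G G \<Psi> by (rule autoD(3)[OF P])
  have sV: "set V \<subseteq> carrier G" "Suc i < length V" using V i by (auto simp: spherical_def)
  obtain xs a b ys where W: "V = xs @ a # b # ys" and j: "i = length xs"
    using sV list_split2 by metis
  have "a \<in> carrier G" "b \<in> carrier G" using sV W by auto
  then show ?thesis
    unfolding W aut_act_def j
    by (cases e) (simp_all add: hurwitz_letter_append)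
qed

lemma aut_act_hurwitz_word:
  assumes P: "\<Psi> \<in> carrier (AutoGroup G)" and V: "V \<in> spherical G r"
  shows "w \<in> braid_words r \<Longrightarrow> aut_act \<Psi> (hurwitz_word G w V) = hurwitz_word G w (aut_act \<Psi> V)"
proof (induction w)
  case (Cons a w)
  obtain i e where a: "a = (i, e)" by force
  have w: "w \<in> braid_words r" "Suc i < r" using Cons.prems by (auto simp: braid_words_def a)
  show ?case
    using Cons.IH[OF w(1)] aut_act_hurwitz[OF P hurwitz_word_closed[OF w(1) V] w(2), of e]
    by (simp add: hurwitz_word_def a)
qed (simp add: hurwitz_word_def)

lemma aut_braid_commute:
  assumes "\<Psi> \<in> carrier (AutoGroup G)" "\<sigma> \<in> carrier (braid_group r)" "V \<in> spherical G r"
  shows "aut_act \<Psi> (braid_act G \<sigma> V) = braid_act G \<sigma> (aut_act \<Psi> V)"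
  using assms by (elim braid_carrierE)
    (simp add: braid_act_class aut_act_closed aut_act_hurwitz_word)

lemma aut_act_mult:
  assumes "\<Psi> \<in> carrier (AutoGroup G)" "\<Phi> \<in> carrier (AutoGroup G)" "V \<in> spherical G r"
  shows "aut_act (\<Psi> \<otimes>\<^bsub>AutoGroup G\<^esub> \<Phi>) V = aut_act \<Psi> (aut_act \<Phi> V)"
proof -
  have "set V \<subseteq> carrier G" using assms by (simp add: spherical_def)
  then show ?thesis using assms
    by (auto simp: aut_act_def AutoGroup_def BijGroup_def auto_def compose_def)
qed

lemma aut_act_one: "V \<in> spherical G r \<Longrightarrow> aut_act \<one>\<^bsub>AutoGroup G\<^esub> V = V"
  by (auto simp: aut_act_def AutoGroup_def BijGroup_def spherical_def intro!: map_idI)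

lemma group_action_of:
  assumes "group H"
    and cl: "\<And>h x. h \<in> carrier H \<Longrightarrow> x \<in> E \<Longrightarrow> f h x \<in> E"
    and one: "\<And>x. x \<in> E \<Longrightarrow> f \<one>\<^bsub>H\<^esub> x = x"
    and mul: "\<And>g h x. g \<in> carrier H \<Longrightarrow> h \<in> carrier H \<Longrightarrow> x \<in> E \<Longrightarrow>
      f (g \<otimes>\<^bsub>H\<^esub> h) x = f g (f h x)"
    and ext: "\<And>h. h \<in> carrier H \<Longrightarrow> f h \<in> extensional E"
  shows "group_action H E f"
proof -
  interpret H: group H by fact
  have B: "f h \<in> Bij E" if h: "h \<in> carrier H" for h
  proof -
    have "f (inv\<^bsub>H\<^esub> h) (f h x) = x" "f h (f (inv\<^bsub>H\<^esub> h) x) = x" if "x \<in> E" for x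
      using mul[of "inv\<^bsub>H\<^esub> h" h x] mul[of h "inv\<^bsub>H\<^esub> h" x] h that one by auto
    then have "bij_betw (f h) E E"
      using cl h by (intro bij_betwI[where g = "f (inv\<^bsub>H\<^esub> h)"]) auto
    then show ?thesis using ext[OF h] by (simp add: Bij_def)
  qed
  have "f \<in> hom H (BijGroup E)"
  proof (rule homI)
    fix g h assume gh: "g \<in> carrier H" "h \<in> carrier H"
    have "f (g \<otimes>\<^bsub>H\<^esub> h) = compose E (f g) (f h)"
      by (rule extensionalityI[where A = E]) (use gh ext mul in \<open>auto simp: compose_eq\<close>)
    then show "f (g \<otimes>\<^bsub>H\<^esub> h) = f g \<otimes>\<^bsub>BijGroup E\<^esub> f h"
      using B gh by (simp add: BijGroup_def)
  qed (use B in \<open>simp add: BijGroup_def\<close>)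
  then show ?thesis
    by (simp add: group_action_def group_hom_def group_hom_axioms_def H.is_group group_BijGroup)
qed

lemma sph_act_apply:
  "V \<in> spherical G r \<Longrightarrow> sph_act G r (\<Psi>, \<sigma>) V = aut_act \<Psi> (braid_act G \<sigma> V)"
  by (simp add: sph_act_def)

lemma group_action_sph_act:
  "group_action (AutoGroup G \<times>\<times> braid_group r) (spherical G r) (sph_act G r)"
proof (rule group_action_of)
  show "group (AutoGroup G \<times>\<times> braid_group r)"
    by (rule DirProd_group[OF AutoGroup group_braid_group])
qed (auto simp: sph_act_apply aut_act_closed braid_act_closed aut_act_one braid_act_one
    aut_act_mult[where r = r] braid_act_mult aut_braid_commute, auto simp: sph_act_def)

lemma group_action_sph_act2:
  "group_action (AutoGroup G \<times>\<times> braid_group r \<times>\<times> braid_group s)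
     (spherical G r \<times> spherical G s) (sph_act2 G r s)"
proof (rule group_action_of)
  show "group (AutoGroup G \<times>\<times> braid_group r \<times>\<times> braid_group s)"
    by (intro DirProd_group AutoGroup group_braid_group)
qed (auto simp: sph_act2_def sph_act_apply aut_act_closed braid_act_closed aut_act_one braid_act_one
    aut_act_mult[where r = r] aut_act_mult[where r = s] braid_act_mult aut_braid_commute)

lemma sph_proj_class:
  assumes V: "V \<in> spherical G r" and W: "W \<in> spherical G s"
  shows "sph_proj G r s (sph_class2 G r s (V, W)) = (sph_class G r V, sph_class G s W)"
proof -
  interpret r: group_action "AutoGroup G \<times>\<times> braid_group r" "spherical G r" "sph_act G r"
    by (rule group_action_sph_act)
  interpret s: group_action "AutoGroup G \<times>\<times> braid_group s" "spherical G s" "sph_act G s"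
    by (rule group_action_sph_act)
  interpret rs: group_action "AutoGroup G \<times>\<times> braid_group r \<times>\<times> braid_group s"
     "spherical G r \<times> spherical G s" "sph_act2 G r s"
    by (rule group_action_sph_act2)
  let ?f = "\<lambda>(V, W). (sph_class G r V, sph_class G s W)"
  have r: "sph_class G r (sph_act G r g V) = sph_class G r V"
    if "g \<in> carrier (AutoGroup G \<times>\<times> braid_group r)" for g
    using r.orbit_act_eq[OF that V] by (simp add: sph_class_def)
  have s: "sph_class G s (sph_act G s g W) = sph_class G s W"
    if "g \<in> carrier (AutoGroup G \<times>\<times> braid_group s)" for g
    using s.orbit_act_eq[OF that W] by (simp add: sph_class_def)
  have eq: "?f p = ?f (V, W)" if p: "p \<in> sph_class2 G r s (V, W)" for p
  proof -
    obtain a t u where "a \<in> carrier (AutoGroup G)" "t \<in> carrier (braid_group r)"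
      "u \<in> carrier (braid_group s)" "p = sph_act2 G r s (a, t, u) (V, W)"
      using p by (auto simp: sph_class2_def orbit_def)
    then show ?thesis using V W r[of "(a, t)"] s[of "(a, u)"] by (simp add: sph_act2_def)
  qed
  have mem: "(V, W) \<in> sph_class2 G r s (V, W)"
    unfolding sph_class2_def by (rule rs.orbit_refl) (simp add: V W)
  have "?f ` sph_class2 G r s (V, W) = (\<lambda>_. ?f (V, W)) ` sph_class2 G r s (V, W)"
    by (rule image_cong[OF refl eq])
  also have "\<dots> = {?f (V, W)}" by (rule image_constant[OF mem])
  finally have "?f ` sph_class2 G r s (V, W) = {?f (V, W)}" .
  then show ?thesis by (simp add: sph_proj_def)
qed

lemma subgroup_BAut:
  assumes V: "V \<in> spherical G r"
  shows "subgroup (BAut G r V) (AutoGroup G)"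
proof -
  interpret A: group "AutoGroup G" by (rule AutoGroup)
  interpret B: group "braid_group r" by (rule group_braid_group)
  show ?thesis
  proof (rule A.subgroupI)
    have "\<one>\<^bsub>AutoGroup G\<^esub> \<in> BAut G r V"
      using aut_act_one[OF V] braid_act_one[OF V] unfolding BAut_def
      by (intro CollectI conjI bexI[of _ "\<one>\<^bsub>braid_group r\<^esub>"]) simp_all
    then show "BAut G r V \<noteq> {}" by blast
  next
    fix a assume a: "a \<in> BAut G r V"
    then obtain t where t: "t \<in> carrier (braid_group r)" "aut_act a V = braid_act G t V"
      and aA: "a \<in> carrier (AutoGroup G)" by (auto simp: BAut_def)
    have "V = aut_act (inv\<^bsub>AutoGroup G\<^esub> a) (braid_act G t V)"
      using aut_act_mult[of "inv\<^bsub>AutoGroup G\<^esub> a" a V r] aA V t aut_act_one by simp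
    then have "braid_act G (inv\<^bsub>braid_group r\<^esub> t) V =
        braid_act G (inv\<^bsub>braid_group r\<^esub> t) (braid_act G t (aut_act (inv\<^bsub>AutoGroup G\<^esub> a) V))"
      using aut_braid_commute[of "inv\<^bsub>AutoGroup G\<^esub> a" t r V] aA t V by simp
    also have "\<dots> = aut_act (inv\<^bsub>AutoGroup G\<^esub> a) V"
      using braid_act_mult[of "inv\<^bsub>braid_group r\<^esub> t" r t] t aA V
      by (simp add: aut_act_closed braid_act_one)
    finally show "inv\<^bsub>AutoGroup G\<^esub> a \<in> BAut G r V"
      using aA t unfolding BAut_def
      by (intro CollectI conjI bexI[of _ "inv\<^bsub>braid_group r\<^esub> t"]) simp_all
  next
    fix a b assume "a \<in> BAut G r V" "b \<in> BAut G r V"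
    then obtain t u where t: "t \<in> carrier (braid_group r)" "aut_act a V = braid_act G t V"
      and u: "u \<in> carrier (braid_group r)" "aut_act b V = braid_act G u V"
      and ab: "a \<in> carrier (AutoGroup G)" "b \<in> carrier (AutoGroup G)" by (auto simp: BAut_def)
    have "aut_act (a \<otimes>\<^bsub>AutoGroup G\<^esub> b) V = braid_act G (u \<otimes>\<^bsub>braid_group r\<^esub> t) V"
      using t u ab V by (simp add: aut_act_mult braid_act_mult aut_braid_commute)
    then show "a \<otimes>\<^bsub>AutoGroup G\<^esub> b \<in> BAut G r V"
      using t u ab unfolding BAut_def
      by (intro CollectI conjI bexI[of _ "u \<otimes>\<^bsub>braid_group r\<^esub> t"]) simp_all
  qed (auto simp: BAut_def)
qed

lemma equiv_qaut_rel:
  assumes "V1 \<in> spherical G r" "V2 \<in> spherical G s"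
  shows "equiv (carrier (AutoGroup G)) (qaut_rel G r s V1 V2)"
proof -
  interpret A: group "AutoGroup G" by (rule AutoGroup)
  interpret S1: subgroup "BAut G r V1" "AutoGroup G" by (rule subgroup_BAut) fact
  interpret S2: subgroup "BAut G s V2" "AutoGroup G" by (rule subgroup_BAut) fact
  show ?thesis
  proof (rule equivI)
    show "qaut_rel G r s V1 V2 \<subseteq> carrier (AutoGroup G) \<times> carrier (AutoGroup G)"
      by (auto simp: qaut_rel_def)
    show "refl_on (carrier (AutoGroup G)) (qaut_rel G r s V1 V2)"
      unfolding refl_on_def qaut_rel_def
      by (auto intro!: bexI[of _ "\<one>\<^bsub>AutoGroup G\<^esub>"])
    show "Relation.sym (qaut_rel G r s V1 V2)"
    proof (rule symI)
      fix P Q assume "(P, Q) \<in> qaut_rel G r s V1 V2"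
      then obtain a b where *: "P \<in> carrier (AutoGroup G)" "Q \<in> carrier (AutoGroup G)"
        "a \<in> BAut G r V1" "b \<in> BAut G s V2" "Q = a \<otimes>\<^bsub>AutoGroup G\<^esub> P \<otimes>\<^bsub>AutoGroup G\<^esub> b"
        by (auto simp: qaut_rel_def)
      have ab: "a \<in> carrier (AutoGroup G)" "b \<in> carrier (AutoGroup G)" using * by auto
      have "P = inv\<^bsub>AutoGroup G\<^esub> a \<otimes>\<^bsub>AutoGroup G\<^esub> Q \<otimes>\<^bsub>AutoGroup G\<^esub> inv\<^bsub>AutoGroup G\<^esub> b"
        using *(1) ab unfolding *(5) by (simp add: A.m_assoc A.mul_inv_cancel)
      then show "(Q, P) \<in> qaut_rel G r s V1 V2"
        using * by (auto simp: qaut_rel_def)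
    qed
    show "Relation.trans (qaut_rel G r s V1 V2)"
    proof (rule transI)
      fix P Q R assume "(P, Q) \<in> qaut_rel G r s V1 V2" "(Q, R) \<in> qaut_rel G r s V1 V2"
      then obtain a b c d where *: "P \<in> carrier (AutoGroup G)" "R \<in> carrier (AutoGroup G)"
        "a \<in> BAut G r V1" "b \<in> BAut G s V2" "c \<in> BAut G r V1" "d \<in> BAut G s V2"
        "R = c \<otimes>\<^bsub>AutoGroup G\<^esub> (a \<otimes>\<^bsub>AutoGroup G\<^esub> P \<otimes>\<^bsub>AutoGroup G\<^esub> b) \<otimes>\<^bsub>AutoGroup G\<^esub> d"
        by (auto simp: qaut_rel_def)
      then have "R = (c \<otimes>\<^bsub>AutoGroup G\<^esub> a) \<otimes>\<^bsub>AutoGroup G\<^esub> P \<otimes>\<^bsub>AutoGroup G\<^esub> (b \<otimes>\<^bsub>AutoGroup G\<^esub> d)"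
        by (simp add: A.m_assoc)
      then show "(P, R) \<in> qaut_rel G r s V1 V2"
        using * unfolding qaut_rel_def by blast
    qed
  qed
qed

end
end

theory Submission
  imports Defs
begin

text \<open>
  Everything rests on one equivalence: \<open>[V1, \<Phi> \<cdot> V2] = [V1, \<Psi> \<cdot> V2]\<close> holds iff \<open>\<Phi>\<close> and \<open>\<Psi>\<close> lie in
  the same double coset (\<open>sph_class2_eq_iff_qaut_rel\<close>). Indeed, an element \<open>(a, \<sigma>, \<tau>)\<close> carrying
  \<open>(V1, \<Phi> \<cdot> V2)\<close> to \<open>(V1, \<Psi> \<cdot> V2)\<close> satisfies \<open>a \<cdot> \<sigma> \<cdot> V1 = V1\<close> and \<open>a \<cdot> \<tau> \<cdot> \<Phi> \<cdot> V2 = \<Psi> \<cdot> V2\<close>.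
  Automorphisms commute with braids, so the first equation says \<open>a \<cdot> V1 = \<sigma>\<^sup>-\<^sup>1 \<cdot> V1\<close>, that is, \<open>a\<close>
  lies in the group \<open>BAut\<close> of \<open>V1\<close>, and the second one says that \<open>b = (a \<Phi>)\<^sup>-\<^sup>1 \<Psi>\<close> acts on \<open>V2\<close> as
  \<open>\<tau>\<close> does. Thus \<open>\<Psi> = a \<Phi> b\<close> is in the double coset of \<open>\<Phi>\<close>, and each step can be reversed.

  The equivalence says at once that \<open>[\<Phi>] \<mapsto> [V1, \<Phi> \<cdot> V2]\<close> is well defined and injective. Its image
  is the fibre: a pair over \<open>([V1], [V2])\<close> has the form \<open>(a \<cdot> \<sigma> \<cdot> V1, b \<cdot> \<tau> \<cdot> V2)\<close>, and
  \<open>(a, \<sigma>, \<tau>)\<^sup>-\<^sup>1\<close> brings it to \<open>(V1, a\<^sup>-\<^sup>1 b \<cdot> V2)\<close> (\<open>sph_fibre_eq_image\<close>).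

  For the change of representatives, \<open>(\<Psi>1, \<sigma>1, \<sigma>2)\<close> carries \<open>(V1, \<Phi> \<cdot> V2)\<close> to
  \<open>(V1', \<Psi>1 \<Phi> \<Psi>2\<^sup>-\<^sup>1 \<cdot> V2')\<close>, because \<open>\<Psi>2\<^sup>-\<^sup>1\<close> strips \<open>\<Psi>2\<close> off \<open>V2'\<close> (\<open>sph_class2_transfer\<close>). This
  is the commutativity of the triangle. By the equivalence for both pairs of representatives, it
  also shows that \<open>\<Phi> \<mapsto> \<Psi>1 \<Phi> \<Psi>2\<^sup>-\<^sup>1\<close> preserves and reflects the double coset relations.
\<close>

section \<open>Maps on a quotient\<close>

lemma the_elem_image_class:
  assumes "equiv A R" "a \<in> A" and "\<And>b. (a, b) \<in> R \<Longrightarrow> f b = f a"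
  shows "the_elem (f ` (R `` {a})) = f a"
proof -
  have "a \<in> R `` {a}" using assms(1,2) by (rule equiv_class_self)
  moreover have "f b = f a" if "b \<in> R `` {a}" for b using that assms(3) by blast
  ultimately have "f ` (R `` {a}) = {f a}" by blast
  then show ?thesis by simp
qed

text \<open>
  Both maps on double cosets send a class to the common value of a function on it. For such a map,
  well-definedness and injectivity are the two directions of a single equivalence.
\<close>

lemma bij_betw_quotient_the_elem:
  assumes eq: "equiv A R"
    and iff: "\<And>a b. a \<in> A \<Longrightarrow> b \<in> A \<Longrightarrow> f a = f b \<longleftrightarrow> (a, b) \<in> R"
  shows "bij_betw (\<lambda>q. the_elem (f ` q)) (A // R) (f ` A)"
proof -
  have val: "the_elem (f ` (R `` {a})) = f a" if a: "a \<in> A" for a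
  proof (rule the_elem_image_class[OF eq a])
    fix b assume "(a, b) \<in> R"
    moreover from this have "b \<in> A" using eq by (auto elim: equivE)
    ultimately show "f b = f a" using iff[OF a] by metis
  qed
  have "inj_on (\<lambda>q. the_elem (f ` q)) (A // R)"
  proof (rule inj_onI)
    fix p q assume "p \<in> A // R" "q \<in> A // R" and e: "the_elem (f ` p) = the_elem (f ` q)"
    then obtain a b where "a \<in> A" "p = R `` {a}" "b \<in> A" "q = R `` {b}"
      by (elim quotientE)
    with e show "p = q" using iff val equiv_class_eq[OF eq, of a b] by simp
  qed
  moreover have "A // R = (\<lambda>a. R `` {a}) ` A" by (auto simp: quotient_def)
  then have "(\<lambda>q. the_elem (f ` q)) ` (A // R) = f ` A"
    using val by (simp add: image_image)
  ultimately show ?thesis by (simp add: bij_betw_def)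
qed

context group begin

section \<open>Orbits of pairs and double cosets\<close>

lemma sph_class2_eq_iff:
  assumes "V \<in> spherical G r" "W \<in> spherical G s" "V' \<in> spherical G r" "W' \<in> spherical G s"
  shows "sph_class2 G r s (V, W) = sph_class2 G r s (V', W') \<longleftrightarrow>
    (\<exists>a \<in> carrier (AutoGroup G). \<exists>\<sigma> \<in> carrier (braid_group r). \<exists>\<tau> \<in> carrier (braid_group s).
      V' = aut_act a (braid_act G \<sigma> V) \<and> W' = aut_act a (braid_act G \<tau> W))"
    (is "?L \<longleftrightarrow> ?R")
proof -
  interpret rs: group_action "AutoGroup G \<times>\<times> braid_group r \<times>\<times> braid_group s"
     "spherical G r \<times> spherical G s" "sph_act2 G r s"
    by (rule group_action_sph_act2)
  have act: "sph_act2 G r s (a, \<sigma>, \<tau>) (V, W) =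
      (aut_act a (braid_act G \<sigma> V), aut_act a (braid_act G \<tau> W))" for a \<sigma> \<tau>
    using assms by (simp add: sph_act2_def sph_act_apply)
  show ?thesis
  proof
    assume ?L
    moreover have "(V', W') \<in> sph_class2 G r s (V', W')"
      unfolding sph_class2_def by (rule rs.orbit_refl) (simp add: assms)
    ultimately have "(V', W') \<in> sph_class2 G r s (V, W)" by simp
    then show ?R by (auto simp: sph_class2_def orbit_def act)
  next
    assume ?R
    then obtain a \<sigma> \<tau> where "a \<in> carrier (AutoGroup G)" "\<sigma> \<in> carrier (braid_group r)"
        "\<tau> \<in> carrier (braid_group s)" "(V', W') = sph_act2 G r s (a, \<sigma>, \<tau>) (V, W)"
      by (auto simp: act)
    then show ?L
      using rs.orbit_act_eq[of "(a, \<sigma>, \<tau>)" "(V, W)"] assms by (simp add: sph_class2_def)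
  qed
qed

lemma sph_class_eqD:
  assumes "W \<in> spherical G r" "sph_class G r V = sph_class G r W" "V \<in> spherical G r"
  obtains a \<sigma> where "a \<in> carrier (AutoGroup G)" "\<sigma> \<in> carrier (braid_group r)"
    "W = aut_act a (braid_act G \<sigma> V)"
proof -
  interpret r: group_action "AutoGroup G \<times>\<times> braid_group r" "spherical G r" "sph_act G r"
    by (rule group_action_sph_act)
  have "W \<in> sph_class G r V"
    unfolding assms(2) unfolding sph_class_def by (rule r.orbit_refl[OF assms(1)])
  then show thesis using that assms(3) by (auto simp: sph_class_def orbit_def sph_act_apply)
qed

lemma aut_act_inv:
  assumes "a \<in> carrier (AutoGroup G)" "V \<in> spherical G r"
  shows "aut_act (inv\<^bsub>AutoGroup G\<^esub> a) (aut_act a V) = V"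
    and "aut_act a (aut_act (inv\<^bsub>AutoGroup G\<^esub> a) V) = V"
proof -
  interpret A: group "AutoGroup G" by (rule AutoGroup)
  show "aut_act (inv\<^bsub>AutoGroup G\<^esub> a) (aut_act a V) = V"
    and "aut_act a (aut_act (inv\<^bsub>AutoGroup G\<^esub> a) V) = V"
    using assms aut_act_mult[symmetric, OF _ _ assms(2)] aut_act_one by simp_all
qed

lemma braid_act_inv:
  assumes "\<sigma> \<in> carrier (braid_group r)" "V \<in> spherical G r"
  shows "braid_act G (inv\<^bsub>braid_group r\<^esub> \<sigma>) (braid_act G \<sigma> V) = V"
proof -
  interpret B: group "braid_group r" by (rule group_braid_group)
  show ?thesis
    using assms braid_act_mult[symmetric, OF _ _ assms(2)] braid_act_one by simp
qed

text \<open>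
  In \<open>\<Psi> = a \<Phi> b\<close>, the left factor \<open>a\<close> is the automorphism that moves the pair, and it fixes \<open>V1\<close> up
  to a braid; the right factor \<open>b\<close> is the discrepancy between \<open>a \<Phi>\<close> and \<open>\<Psi>\<close> on \<open>V2\<close>, and it is
  made up for by the braid acting on the second entry.
\<close>

lemma sph_class2_eq_iff_qaut_rel:
  assumes V1: "V1 \<in> spherical G r" and V2: "V2 \<in> spherical G s"
    and P: "\<Phi> \<in> carrier (AutoGroup G)" and Q: "\<Psi> \<in> carrier (AutoGroup G)"
  shows "sph_class2 G r s (V1, aut_act \<Phi> V2) = sph_class2 G r s (V1, aut_act \<Psi> V2) \<longleftrightarrow>
    (\<Phi>, \<Psi>) \<in> qaut_rel G r s V1 V2" (is "?L \<longleftrightarrow> ?R")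
proof -
  interpret A: group "AutoGroup G" by (rule AutoGroup)
  interpret Br: group "braid_group r" by (rule group_braid_group)
  note iff = sph_class2_eq_iff[OF V1 aut_act_closed[OF P V2] V1 aut_act_closed[OF Q V2]]
  show ?thesis
  proof
    assume ?L
    then obtain a \<sigma> \<tau> where a: "a \<in> carrier (AutoGroup G)"
      and \<sigma>: "\<sigma> \<in> carrier (braid_group r)" and \<tau>: "\<tau> \<in> carrier (braid_group s)"
      and 1: "V1 = aut_act a (braid_act G \<sigma> V1)"
      and 2: "aut_act \<Psi> V2 = aut_act a (braid_act G \<tau> (aut_act \<Phi> V2))"
      unfolding iff by blast
    have "V1 = braid_act G \<sigma> (aut_act a V1)"
      using 1 aut_braid_commute[OF a \<sigma> V1] by simp
    then have "braid_act G (inv\<^bsub>braid_group r\<^esub> \<sigma>) V1 = aut_act a V1"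
      using braid_act_inv[OF \<sigma> aut_act_closed[OF a V1]] by metis
    then have a1: "a \<in> BAut G r V1"
      unfolding BAut_def using a Br.inv_closed[OF \<sigma>] by force
    let ?c = "a \<otimes>\<^bsub>AutoGroup G\<^esub> \<Phi>"
    have c: "?c \<in> carrier (AutoGroup G)" using a P by simp
    let ?b = "inv\<^bsub>AutoGroup G\<^esub> ?c \<otimes>\<^bsub>AutoGroup G\<^esub> \<Psi>"
    have "aut_act \<Psi> V2 = aut_act ?c (braid_act G \<tau> V2)"
      using 2 aut_braid_commute[OF P \<tau> V2] aut_act_mult[OF a P braid_act_closed[OF \<tau> V2]] by simp
    then have "aut_act ?b V2 = braid_act G \<tau> V2"
      using aut_act_mult[OF A.inv_closed[OF c] Q V2]
        aut_act_inv(1)[OF c braid_act_closed[OF \<tau> V2]] by simp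
    then have b: "?b \<in> BAut G s V2"
      using c Q \<tau> by (auto simp: BAut_def)
    have "\<Psi> = ?c \<otimes>\<^bsub>AutoGroup G\<^esub> ?b"
      using A.mul_inv_cancel(1)[OF c Q] by simp
    then show ?R using a1 b P Q by (auto simp: qaut_rel_def)
  next
    assume ?R
    then obtain a b where a1: "a \<in> BAut G r V1" and b1: "b \<in> BAut G s V2"
      and Q_eq: "\<Psi> = a \<otimes>\<^bsub>AutoGroup G\<^esub> \<Phi> \<otimes>\<^bsub>AutoGroup G\<^esub> b"
      by (auto simp: qaut_rel_def)
    obtain \<sigma> where a: "a \<in> carrier (AutoGroup G)" and \<sigma>: "\<sigma> \<in> carrier (braid_group r)"
      and 1: "aut_act a V1 = braid_act G \<sigma> V1" using a1 by (auto simp: BAut_def)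
    obtain \<tau> where b: "b \<in> carrier (AutoGroup G)" and \<tau>: "\<tau> \<in> carrier (braid_group s)"
      and 2: "aut_act b V2 = braid_act G \<tau> V2" using b1 by (auto simp: BAut_def)
    have "V1 = aut_act a (braid_act G (inv\<^bsub>braid_group r\<^esub> \<sigma>) V1)"
      using aut_braid_commute[OF a Br.inv_closed[OF \<sigma>] V1] 1 braid_act_inv[OF \<sigma> V1] by simp
    moreover have "aut_act \<Psi> V2 = aut_act a (braid_act G \<tau> (aut_act \<Phi> V2))"
      using a b P V2 \<tau> 2
      by (simp add: Q_eq aut_act_mult[where r = s] aut_act_closed braid_act_closed
          aut_braid_commute)
    ultimately show ?L unfolding iff using a \<tau> Br.inv_closed[OF \<sigma>] by blast
  qed
qed

section \<open>The fibre as a double coset space\<close>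

lemma qaut_map_class:
  assumes "V1 \<in> spherical G r" "V2 \<in> spherical G s" "\<Phi> \<in> carrier (AutoGroup G)"
  shows "qaut_map G r s V1 V2 (qaut_class G r s V1 V2 \<Phi>) = sph_class2 G r s (V1, aut_act \<Phi> V2)"
  unfolding qaut_map_def qaut_class_def
proof (rule the_elem_image_class[OF equiv_qaut_rel])
  fix \<Psi> assume R: "(\<Phi>, \<Psi>) \<in> qaut_rel G r s V1 V2"
  then have "\<Psi> \<in> carrier (AutoGroup G)" by (simp add: qaut_rel_def)
  then show "sph_class2 G r s (V1, aut_act \<Psi> V2) = sph_class2 G r s (V1, aut_act \<Phi> V2)"
    using sph_class2_eq_iff_qaut_rel[OF assms] R by metis
qed (use assms in simp_all)

text \<open>
  A pair over \<open>([V1], [V2])\<close> can be moved so that its first entry becomes \<open>V1\<close>; the automorphism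
  needed for this is applied to the second entry as well, whereas the braids act separately and
  can be removed from both entries.
\<close>

lemma sph_fibre_eq_image:
  assumes V1: "V1 \<in> spherical G r" and V2: "V2 \<in> spherical G s"
  shows "sph_fibre G r s (sph_class G r V1, sph_class G s V2) =
    (\<lambda>\<Phi>. sph_class2 G r s (V1, aut_act \<Phi> V2)) ` carrier (AutoGroup G)"
proof -
  interpret A: group "AutoGroup G" by (rule AutoGroup)
  interpret Bs: group "braid_group s" by (rule group_braid_group)
  interpret s: group_action "AutoGroup G \<times>\<times> braid_group s" "spherical G s" "sph_act G s"
    by (rule group_action_sph_act)
  show ?thesis
  proof (intro subset_antisym subsetI)
    fix c assume "c \<in> sph_fibre G r s (sph_class G r V1, sph_class G s V2)"
    then obtain W1 W2 where W1: "W1 \<in> spherical G r" and W2: "W2 \<in> spherical G s"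
      and c: "c = sph_class2 G r s (W1, W2)"
      and p: "sph_proj G r s c = (sph_class G r V1, sph_class G s V2)"
      by (auto simp: sph_fibre_def sph_quot2_def orbits_def sph_class2_def)
    have cl: "sph_class G r V1 = sph_class G r W1" "sph_class G s V2 = sph_class G s W2"
      using p sph_proj_class[OF W1 W2] by (simp_all add: c)
    obtain a \<sigma> where a: "a \<in> carrier (AutoGroup G)" and \<sigma>: "\<sigma> \<in> carrier (braid_group r)"
      and W1_eq: "W1 = aut_act a (braid_act G \<sigma> V1)"
      by (rule sph_class_eqD[OF W1 cl(1) V1])
    obtain b \<tau> where b: "b \<in> carrier (AutoGroup G)" and \<tau>: "\<tau> \<in> carrier (braid_group s)"
      and W2_eq: "W2 = aut_act b (braid_act G \<tau> V2)"
      by (rule sph_class_eqD[OF W2 cl(2) V2])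
    let ?\<Phi> = "inv\<^bsub>AutoGroup G\<^esub> a \<otimes>\<^bsub>AutoGroup G\<^esub> b"
    have F: "?\<Phi> \<in> carrier (AutoGroup G)" using a b by simp
    have "aut_act a (braid_act G \<tau> (aut_act ?\<Phi> V2)) =
        aut_act a (aut_act ?\<Phi> (braid_act G \<tau> V2))"
      using aut_braid_commute[OF F \<tau> V2] by simp
    also have "\<dots> = aut_act a (aut_act (inv\<^bsub>AutoGroup G\<^esub> a) W2)"
      using aut_act_mult[OF A.inv_closed[OF a] b braid_act_closed[OF \<tau> V2]] W2_eq by simp
    also have "\<dots> = W2" by (rule aut_act_inv(2)[OF a W2])
    finally have "sph_class2 G r s (V1, aut_act ?\<Phi> V2) = c"
      unfolding c sph_class2_eq_iff[OF V1 aut_act_closed[OF F V2] W1 W2]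
      using a \<sigma> \<tau> W1_eq by metis
    then show "c \<in> (\<lambda>\<Phi>. sph_class2 G r s (V1, aut_act \<Phi> V2)) ` carrier (AutoGroup G)"
      using F by blast
  next
    fix c assume "c \<in> (\<lambda>\<Phi>. sph_class2 G r s (V1, aut_act \<Phi> V2)) ` carrier (AutoGroup G)"
    then obtain \<Phi> where P: "\<Phi> \<in> carrier (AutoGroup G)"
      and c: "c = sph_class2 G r s (V1, aut_act \<Phi> V2)" by blast
    have "sph_class G s (aut_act \<Phi> V2) = sph_class G s V2"
      using s.orbit_act_eq[of "(\<Phi>, \<one>\<^bsub>braid_group s\<^esub>)" V2] P V2
      by (simp add: sph_class_def sph_act_apply braid_act_one)
    then show "c \<in> sph_fibre G r s (sph_class G r V1, sph_class G s V2)"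
      using V1 aut_act_closed[OF P V2] sph_proj_class[OF V1 aut_act_closed[OF P V2]]
      by (auto simp: c sph_fibre_def sph_quot2_def orbits_def sph_class2_def)
  qed
qed

lemma bij_betw_qaut_map:
  assumes "V1 \<in> spherical G r" "V2 \<in> spherical G s"
  shows "bij_betw (qaut_map G r s V1 V2) (QAut G r s V1 V2)
    (sph_fibre G r s (sph_class G r V1, sph_class G s V2))"
  unfolding sph_fibre_eq_image[OF assms] QAut_def qaut_map_def[abs_def]
  by (rule bij_betw_quotient_the_elem[OF equiv_qaut_rel[OF assms]])
    (rule sph_class2_eq_iff_qaut_rel[OF assms])

section \<open>Change of representatives\<close>

lemma sph_act_closed:
  assumes "a \<in> carrier (AutoGroup G)" "\<sigma> \<in> carrier (braid_group r)" "V \<in> spherical G r"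
  shows "sph_act G r (a, \<sigma>) V \<in> spherical G r"
  using assms by (simp add: sph_act_apply aut_act_closed braid_act_closed)

lemma sph_class_sph_act:
  assumes "a \<in> carrier (AutoGroup G)" "\<sigma> \<in> carrier (braid_group r)" "V \<in> spherical G r"
  shows "sph_class G r (sph_act G r (a, \<sigma>) V) = sph_class G r V"
  unfolding sph_class_def
  by (rule group_action.orbit_act_eq[OF group_action_sph_act]) (use assms in simp_all)

text \<open>
  The element \<open>(\<Psi>1, \<sigma>1, \<sigma>2)\<close> carries the first pair to the second one: on the second entry,
  \<open>\<Psi>2\<^sup>-\<^sup>1\<close> undoes \<open>\<Psi>2\<close>, and the braid \<open>\<sigma>2\<close> that remains can be moved past \<open>\<Phi>\<close>.
\<close>

lemma sph_class2_transfer: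
  assumes V1: "V1 \<in> spherical G r" and V2: "V2 \<in> spherical G s"
    and P1: "\<Psi>1 \<in> carrier (AutoGroup G)" and \<sigma>1: "\<sigma>1 \<in> carrier (braid_group r)"
    and P2: "\<Psi>2 \<in> carrier (AutoGroup G)" and \<sigma>2: "\<sigma>2 \<in> carrier (braid_group s)"
    and P: "\<Phi> \<in> carrier (AutoGroup G)"
  shows "sph_class2 G r s (V1, aut_act \<Phi> V2) =
    sph_class2 G r s (sph_act G r (\<Psi>1, \<sigma>1) V1,
      aut_act (\<Psi>1 \<otimes>\<^bsub>AutoGroup G\<^esub> \<Phi> \<otimes>\<^bsub>AutoGroup G\<^esub> inv\<^bsub>AutoGroup G\<^esub> \<Psi>2)
        (sph_act G s (\<Psi>2, \<sigma>2) V2))"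
proof -
  interpret A: group "AutoGroup G" by (rule AutoGroup)
  let ?T = "\<Psi>1 \<otimes>\<^bsub>AutoGroup G\<^esub> \<Phi> \<otimes>\<^bsub>AutoGroup G\<^esub> inv\<^bsub>AutoGroup G\<^esub> \<Psi>2"
  have T: "?T \<in> carrier (AutoGroup G)" using P1 P P2 by simp
  note W2 = sph_act_closed[OF P2 \<sigma>2 V2]
  have "aut_act ?T (sph_act G s (\<Psi>2, \<sigma>2) V2) = aut_act \<Psi>1 (aut_act \<Phi> (braid_act G \<sigma>2 V2))"
    using P1 P P2 V2 \<sigma>2 aut_act_inv(1)[OF P2 braid_act_closed[OF \<sigma>2 V2]]
    by (simp add: sph_act_apply aut_act_mult[where r = s] aut_act_closed braid_act_closed)
  also have "\<dots> = aut_act \<Psi>1 (braid_act G \<sigma>2 (aut_act \<Phi> V2))"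
    using aut_braid_commute[OF P \<sigma>2 V2] by simp
  finally show ?thesis
    unfolding sph_class2_eq_iff[OF V1 aut_act_closed[OF P V2] sph_act_closed[OF P1 \<sigma>1 V1]
        aut_act_closed[OF T W2]]
    using P1 \<sigma>1 \<sigma>2 sph_act_apply[OF V1] by blast
qed

text \<open>
  Each of the two double coset relations says when two automorphisms give the same orbit of pairs,
  and by \<open>sph_class2_transfer\<close> the automorphisms \<open>\<Phi>\<close> and \<open>\<Psi>1 \<Phi> \<Psi>2\<^sup>-\<^sup>1\<close> give the same orbit.
\<close>

lemma qaut_class_transfer_eq_iff:
  assumes V1: "V1 \<in> spherical G r" and V2: "V2 \<in> spherical G s"
    and P1: "\<Psi>1 \<in> carrier (AutoGroup G)" and \<sigma>1: "\<sigma>1 \<in> carrier (braid_group r)"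
    and P2: "\<Psi>2 \<in> carrier (AutoGroup G)" and \<sigma>2: "\<sigma>2 \<in> carrier (braid_group s)"
    and P: "\<Phi> \<in> carrier (AutoGroup G)" and Q: "\<Psi> \<in> carrier (AutoGroup G)"
    and V1': "V1' = sph_act G r (\<Psi>1, \<sigma>1) V1" and V2': "V2' = sph_act G s (\<Psi>2, \<sigma>2) V2"
  shows "qaut_class G r s V1' V2'
        (\<Psi>1 \<otimes>\<^bsub>AutoGroup G\<^esub> \<Phi> \<otimes>\<^bsub>AutoGroup G\<^esub> inv\<^bsub>AutoGroup G\<^esub> \<Psi>2) =
      qaut_class G r s V1' V2'
        (\<Psi>1 \<otimes>\<^bsub>AutoGroup G\<^esub> \<Psi> \<otimes>\<^bsub>AutoGroup G\<^esub> inv\<^bsub>AutoGroup G\<^esub> \<Psi>2) \<longleftrightarrow>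
    (\<Phi>, \<Psi>) \<in> qaut_rel G r s V1 V2"
    (is "qaut_class G r s V1' V2' (?t \<Phi>) = qaut_class G r s V1' V2' (?t \<Psi>) \<longleftrightarrow> _")
proof -
  interpret A: group "AutoGroup G" by (rule AutoGroup)
  have S: "V1' \<in> spherical G r" "V2' \<in> spherical G s"
    unfolding V1' V2' by (rule sph_act_closed; fact)+
  have T: "?t \<Phi> \<in> carrier (AutoGroup G)" "?t \<Psi> \<in> carrier (AutoGroup G)"
    using P1 P P2 Q by simp_all
  have "qaut_class G r s V1' V2' (?t \<Phi>) = qaut_class G r s V1' V2' (?t \<Psi>) \<longleftrightarrow>
      (?t \<Phi>, ?t \<Psi>) \<in> qaut_rel G r s V1' V2'"
    unfolding qaut_class_def by (rule eq_equiv_class_iff[OF equiv_qaut_rel[OF S] T])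
  also have "\<dots> \<longleftrightarrow>
      sph_class2 G r s (V1, aut_act \<Phi> V2) = sph_class2 G r s (V1, aut_act \<Psi> V2)"
    using sph_class2_eq_iff_qaut_rel[OF S T]
      sph_class2_transfer[OF V1 V2 P1 \<sigma>1 P2 \<sigma>2 P] sph_class2_transfer[OF V1 V2 P1 \<sigma>1 P2 \<sigma>2 Q]
    by (simp add: V1' V2')
  also have "\<dots> \<longleftrightarrow> (\<Phi>, \<Psi>) \<in> qaut_rel G r s V1 V2"
    by (rule sph_class2_eq_iff_qaut_rel[OF V1 V2 P Q])
  finally show ?thesis .
qed

lemma qaut_transfer_class:
  assumes V1: "V1 \<in> spherical G r" and V2: "V2 \<in> spherical G s"
    and P1: "\<Psi>1 \<in> carrier (AutoGroup G)" and \<sigma>1: "\<sigma>1 \<in> carrier (braid_group r)"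
    and P2: "\<Psi>2 \<in> carrier (AutoGroup G)" and \<sigma>2: "\<sigma>2 \<in> carrier (braid_group s)"
    and P: "\<Phi> \<in> carrier (AutoGroup G)"
    and V1': "V1' = sph_act G r (\<Psi>1, \<sigma>1) V1" and V2': "V2' = sph_act G s (\<Psi>2, \<sigma>2) V2"
  shows "qaut_transfer G r s V1' V2' \<Psi>1 \<Psi>2 (qaut_class G r s V1 V2 \<Phi>) =
    qaut_class G r s V1' V2'
      (\<Psi>1 \<otimes>\<^bsub>AutoGroup G\<^esub> \<Phi> \<otimes>\<^bsub>AutoGroup G\<^esub> inv\<^bsub>AutoGroup G\<^esub> \<Psi>2)"
  unfolding qaut_transfer_def qaut_class_def[of _ _ _ V1]
proof (rule the_elem_image_class[OF equiv_qaut_rel[OF V1 V2] P])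
  fix \<Psi> assume R: "(\<Phi>, \<Psi>) \<in> qaut_rel G r s V1 V2"
  then have Q: "\<Psi> \<in> carrier (AutoGroup G)" by (simp add: qaut_rel_def)
  show "qaut_class G r s V1' V2'
        (\<Psi>1 \<otimes>\<^bsub>AutoGroup G\<^esub> \<Psi> \<otimes>\<^bsub>AutoGroup G\<^esub> inv\<^bsub>AutoGroup G\<^esub> \<Psi>2) =
      qaut_class G r s V1' V2'
        (\<Psi>1 \<otimes>\<^bsub>AutoGroup G\<^esub> \<Phi> \<otimes>\<^bsub>AutoGroup G\<^esub> inv\<^bsub>AutoGroup G\<^esub> \<Psi>2)"
    using qaut_class_transfer_eq_iff[OF V1 V2 P1 \<sigma>1 P2 \<sigma>2 P Q V1' V2'] R by metis
qed

lemma bij_betw_qaut_transfer: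
  assumes V1: "V1 \<in> spherical G r" and V2: "V2 \<in> spherical G s"
    and P1: "\<Psi>1 \<in> carrier (AutoGroup G)" and \<sigma>1: "\<sigma>1 \<in> carrier (braid_group r)"
    and P2: "\<Psi>2 \<in> carrier (AutoGroup G)" and \<sigma>2: "\<sigma>2 \<in> carrier (braid_group s)"
    and V1': "V1' = sph_act G r (\<Psi>1, \<sigma>1) V1" and V2': "V2' = sph_act G s (\<Psi>2, \<sigma>2) V2"
  shows "bij_betw (qaut_transfer G r s V1' V2' \<Psi>1 \<Psi>2) (QAut G r s V1 V2) (QAut G r s V1' V2')"
proof -
  interpret A: group "AutoGroup G" by (rule AutoGroup)
  let ?t = "\<lambda>\<Phi>. \<Psi>1 \<otimes>\<^bsub>AutoGroup G\<^esub> \<Phi> \<otimes>\<^bsub>AutoGroup G\<^esub> inv\<^bsub>AutoGroup G\<^esub> \<Psi>2"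
  have "?t ` carrier (AutoGroup G) = carrier (AutoGroup G)"
  proof (intro subset_antisym subsetI)
    fix \<Phi> assume P: "\<Phi> \<in> carrier (AutoGroup G)"
    let ?X = "inv\<^bsub>AutoGroup G\<^esub> \<Psi>1 \<otimes>\<^bsub>AutoGroup G\<^esub> \<Phi> \<otimes>\<^bsub>AutoGroup G\<^esub> \<Psi>2"
    have "?X \<in> carrier (AutoGroup G)" "?t ?X = \<Phi>"
      using P P1 P2 by (simp_all add: A.m_assoc A.mul_inv_cancel)
    then show "\<Phi> \<in> ?t ` carrier (AutoGroup G)" by (metis imageI)
  qed (use P1 P2 in auto)
  then have "qaut_class G r s V1' V2' ` ?t ` carrier (AutoGroup G) = QAut G r s V1' V2'"
    by (auto simp: QAut_def quotient_def qaut_class_def)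
  then have im: "QAut G r s V1' V2' =
      (\<lambda>\<Phi>. qaut_class G r s V1' V2' (?t \<Phi>)) ` carrier (AutoGroup G)"
    by (simp only: image_image)
  show ?thesis
    unfolding im QAut_def[of _ _ _ V1] qaut_transfer_def[abs_def]
    by (rule bij_betw_quotient_the_elem[OF equiv_qaut_rel[OF V1 V2]])
      (rule qaut_class_transfer_eq_iff[OF V1 V2 P1 \<sigma>1 P2 \<sigma>2 _ _ V1' V2'])
qed

lemma qaut_map_transfer:
  assumes V1: "V1 \<in> spherical G r" and V2: "V2 \<in> spherical G s"
    and P1: "\<Psi>1 \<in> carrier (AutoGroup G)" and \<sigma>1: "\<sigma>1 \<in> carrier (braid_group r)"
    and P2: "\<Psi>2 \<in> carrier (AutoGroup G)" and \<sigma>2: "\<sigma>2 \<in> carrier (braid_group s)"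
    and V1': "V1' = sph_act G r (\<Psi>1, \<sigma>1) V1" and V2': "V2' = sph_act G s (\<Psi>2, \<sigma>2) V2"
    and q: "q \<in> QAut G r s V1 V2"
  shows "qaut_map G r s V1' V2' (qaut_transfer G r s V1' V2' \<Psi>1 \<Psi>2 q) = qaut_map G r s V1 V2 q"
proof -
  interpret A: group "AutoGroup G" by (rule AutoGroup)
  obtain \<Phi> where P: "\<Phi> \<in> carrier (AutoGroup G)" and q: "q = qaut_class G r s V1 V2 \<Phi>"
    using q by (auto simp: QAut_def qaut_class_def elim: quotientE)
  have "V1' \<in> spherical G r" "V2' \<in> spherical G s"
    unfolding V1' V2' by (rule sph_act_closed; fact)+
  then show ?thesis
    using P P1 P2 sph_class2_transfer[OF V1 V2 P1 \<sigma>1 P2 \<sigma>2 P]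
    by (simp add: q qaut_transfer_class[OF V1 V2 P1 \<sigma>1 P2 \<sigma>2 P V1' V2'] qaut_map_class V1 V2)
      (simp add: V1' V2')
qed

end

theorem theorem1p19:
  fixes G :: "('a, 'b) monoid_scheme" and r s :: nat
    and x :: "'a list set \<times> 'a list set" and V1 V2 :: "'a list"
  assumes "group G" and "finite (carrier G)"
    and "x \<in> sph_quot G r \<times> sph_quot G s"
    and "V1 \<in> spherical G r" and "V2 \<in> spherical G s"
    and "x = (sph_class G r V1, sph_class G s V2)"
  shows
    "(\<forall>\<Phi> \<in> carrier (AutoGroup G). \<forall>\<Psi> \<in> carrier (AutoGroup G).
        qaut_class G r s V1 V2 \<Phi> = qaut_class G r s V1 V2 \<Psi> \<longrightarrow>
        sph_class2 G r s (V1, aut_act \<Phi> V2) = sph_class2 G r s (V1, aut_act \<Psi> V2))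
     \<and>
     ((\<forall>\<Phi> \<in> carrier (AutoGroup G).
         qaut_map G r s V1 V2 (qaut_class G r s V1 V2 \<Phi>) = sph_class2 G r s (V1, aut_act \<Phi> V2)) \<and>
      bij_betw (qaut_map G r s V1 V2) (QAut G r s V1 V2) (sph_fibre G r s x) \<and>
      card (sph_fibre G r s x) = card (QAut G r s V1 V2))
     \<and>
     (\<forall>\<Psi>1 \<in> carrier (AutoGroup G). \<forall>\<sigma>1 \<in> carrier (braid_group r).
      \<forall>\<Psi>2 \<in> carrier (AutoGroup G). \<forall>\<sigma>2 \<in> carrier (braid_group s). \<forall>V1' V2'.
        V1' = sph_act G r (\<Psi>1, \<sigma>1) V1 \<and> V2' = sph_act G s (\<Psi>2, \<sigma>2) V2 \<longrightarrow>
        (\<forall>\<Phi> \<in> carrier (AutoGroup G).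
           qaut_transfer G r s V1' V2' \<Psi>1 \<Psi>2 (qaut_class G r s V1 V2 \<Phi>) =
           qaut_class G r s V1' V2'
             (\<Psi>1 \<otimes>\<^bsub>AutoGroup G\<^esub> \<Phi> \<otimes>\<^bsub>AutoGroup G\<^esub> inv\<^bsub>AutoGroup G\<^esub> \<Psi>2)) \<and>
        bij_betw (qaut_transfer G r s V1' V2' \<Psi>1 \<Psi>2) (QAut G r s V1 V2) (QAut G r s V1' V2') \<and>
        bij_betw (qaut_map G r s V1' V2') (QAut G r s V1' V2') (sph_fibre G r s x) \<and>
        (\<forall>q \<in> QAut G r s V1 V2.
           qaut_map G r s V1' V2' (qaut_transfer G r s V1' V2' \<Psi>1 \<Psi>2 q) = qaut_map G r s V1 V2 q))"
proof (intro conjI ballI allI impI)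
  interpret group G by fact
  note V = \<open>V1 \<in> spherical G r\<close> \<open>V2 \<in> spherical G s\<close>
  note x = \<open>x = (sph_class G r V1, sph_class G s V2)\<close>
  show "sph_class2 G r s (V1, aut_act \<Phi> V2) = sph_class2 G r s (V1, aut_act \<Psi> V2)"
    if "\<Phi> \<in> carrier (AutoGroup G)" "\<Psi> \<in> carrier (AutoGroup G)"
      "qaut_class G r s V1 V2 \<Phi> = qaut_class G r s V1 V2 \<Psi>" for \<Phi> \<Psi>
    using that qaut_map_class[OF V] by metis
  show "qaut_map G r s V1 V2 (qaut_class G r s V1 V2 \<Phi>) = sph_class2 G r s (V1, aut_act \<Phi> V2)"
    if "\<Phi> \<in> carrier (AutoGroup G)" for \<Phi>
    by (rule qaut_map_class[OF V that])
  show bij: "bij_betw (qaut_map G r s V1 V2) (QAut G r s V1 V2) (sph_fibre G r s x)"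
    unfolding x by (rule bij_betw_qaut_map[OF V])
  show "card (sph_fibre G r s x) = card (QAut G r s V1 V2)"
    using bij_betw_same_card[OF bij] by simp

  fix \<Psi>1 \<sigma>1 \<Psi>2 \<sigma>2 V1' V2'
  assume \<Psi>1: "\<Psi>1 \<in> carrier (AutoGroup G)" and \<sigma>1: "\<sigma>1 \<in> carrier (braid_group r)"
    and \<Psi>2: "\<Psi>2 \<in> carrier (AutoGroup G)" and \<sigma>2: "\<sigma>2 \<in> carrier (braid_group s)"
    and V': "V1' = sph_act G r (\<Psi>1, \<sigma>1) V1 \<and> V2' = sph_act G s (\<Psi>2, \<sigma>2) V2"
  note hyps = V \<Psi>1 \<sigma>1 \<Psi>2 \<sigma>2
  note V1' = conjunct1[OF V'] and V2' = conjunct2[OF V']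
  show "qaut_transfer G r s V1' V2' \<Psi>1 \<Psi>2 (qaut_class G r s V1 V2 \<Phi>) =
      qaut_class G r s V1' V2'
        (\<Psi>1 \<otimes>\<^bsub>AutoGroup G\<^esub> \<Phi> \<otimes>\<^bsub>AutoGroup G\<^esub> inv\<^bsub>AutoGroup G\<^esub> \<Psi>2)"
    if "\<Phi> \<in> carrier (AutoGroup G)" for \<Phi>
    by (rule qaut_transfer_class[OF hyps that V1' V2'])
  show "bij_betw (qaut_transfer G r s V1' V2' \<Psi>1 \<Psi>2) (QAut G r s V1 V2) (QAut G r s V1' V2')"
    by (rule bij_betw_qaut_transfer[OF hyps V1' V2'])
  have "V1' \<in> spherical G r" "V2' \<in> spherical G s"
    unfolding V1' V2' by (rule sph_act_closed; fact)+
  moreover have "x = (sph_class G r V1', sph_class G s V2')"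
    using hyps by (simp add: x V1' V2' sph_class_sph_act)
  ultimately show "bij_betw (qaut_map G r s V1' V2') (QAut G r s V1' V2') (sph_fibre G r s x)"
    using bij_betw_qaut_map by simp
  show "qaut_map G r s V1' V2' (qaut_transfer G r s V1' V2' \<Psi>1 \<Psi>2 q) = qaut_map G r s V1 V2 q"
    if "q \<in> QAut G r s V1 V2" for q
    by (rule qaut_map_transfer[OF hyps V1' V2' that])
qed

end
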